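(* Let $G$ be a torsion-free additive abelian group, let $h\geq 2$ be an integer, and let $k\geq 4$ be an integer. Then $$\mathcal{R}_{G}(h,k)\cap[hk-h+2,\,hk-1]=\varnothing.$$ That is, there is no subset $A\subseteq G$ with $|A|=k$ such that $hk-h+2\leq |hA|\leq hk-1$.
   Context: For an integer $h\geq 2$ and a subset $A$ of an additive abelian group $G$, the $h$-fold sumset is $hA=\{a_1+\cdots+a_h : a_1,\dots,a_h\in A\}$ (the $a_i$ need not be distinct). For a positive integer $k$, $\mathcal{R}_G(h,k)=\{|hA| : A\subseteq G,\ |A|=k\}$. For integers $a\le b$, $[a,b]$ denotes the set of integers $c$ with $a\leq c\leq b$. A group $G$ is torsion-free if for every nonzero $g\in G$ and every positive integer $n$, $ng\neq 0$. *)

theory Defs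
  imports Main
begin

text \<open>The group \<open>G\<close> is an arbitrary type of class \<^class>\<open>ab_group_add\<close>; where a notion depends on
  the whole group, the group is passed as a value of type \<open>'a itself\<close>.\<close>

text \<open>The multiple \<open>n g\<close> of a group element is written as the sum of \<open>n\<close> copies of \<open>g\<close>.\<close>

definition torsion_free :: "'a::ab_group_add itself \<Rightarrow> bool" where
  "torsion_free _ \<longleftrightarrow> (\<forall>g::'a. \<forall>n::nat. g \<noteq> 0 \<longrightarrow> n > 0 \<longrightarrow> (\<Sum>i=1..n. g) \<noteq> 0)"

definition hfold_sumset :: "nat \<Rightarrow> 'a::ab_group_add set \<Rightarrow> 'a set" where
  "hfold_sumset h A = {(\<Sum>i=1..h. a i) | a. \<forall>i\<in>{1..h}. a i \<in> A}"

definition sumset_sizes :: "'a::ab_group_add itself \<Rightarrow> nat \<Rightarrow> nat \<Rightarrow> nat set" where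
  "sumset_sizes _ h k = {card (hfold_sumset h A) | A :: 'a set. finite A \<and> card A = k}"

end

(* A torsion-free abelian group carries a translation-invariant linear order: a maximal cone P with
   P and -P meeting only in 0 is closed under taking roots, hence total. In an ordered group the sums
   along any monotone lattice path in the table a_i + b_j increase strictly, so |A + B| >= |A| + |B| - 1,
   and swapping one corner of the path shows that equality forces A to be an arithmetic progression.
   Hence if A is not a progression, every further summand A adds at least k elements and |hA| >= hk;
   if A is a progression, |hA| <= hk - h + 1. *)
theory Submission
  imports Defs
begin

section \<open>Torsion-free groups: multiples, cones and invariant orders\<close>

definition multiple :: "nat \<Rightarrow> 'a::ab_group_add \<Rightarrow> 'a" where
  "multiple n g = (\<Sum>i=1..n. g)"

lemma multiple_0 [simp]: "multiple 0 g = 0"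
  and multiple_Suc: "multiple (Suc n) g = g + multiple n g"
  by (simp_all add: multiple_def add.commute)

lemma multiple_add_left: "multiple (m + n) g = multiple m g + multiple n g"
  by (induction m) (simp_all add: multiple_Suc algebra_simps)

lemma multiple_add_right: "multiple n (g + h) = multiple n g + multiple n h"
  by (simp add: multiple_def sum.distrib)

lemma multiple_minus: "multiple n (- g) = - multiple n g"
  by (simp add: multiple_def sum_negf)

lemma multiple_zero [simp]: "multiple n 0 = 0"
  by (simp add: multiple_def)

lemma multiple_mult: "multiple (m * n) g = multiple m (multiple n g)"
  by (induction m) (simp_all add: multiple_Suc multiple_add_left)

lemma torsion_free_multiple:
  assumes "torsion_free TYPE('a::ab_group_add)" "multiple n (g::'a) = 0" "n > 0"
  shows "g = 0"
  using assms unfolding torsion_free_def multiple_def by blast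

text \<open>Such a set is the set of nonnegative elements of a translation-invariant partial order,
  x <= y meaning that y - x lies in \<open>P\<close>. Closure under addition encodes transitivity,
  and the last clause antisymmetry.\<close>

definition cone :: "'a::ab_group_add set \<Rightarrow> bool" where
  "cone P \<longleftrightarrow> 0 \<in> P \<and> (\<forall>x\<in>P. \<forall>y\<in>P. x + y \<in> P) \<and> (\<forall>x\<in>P. - x \<in> P \<longrightarrow> x = 0)"

lemma multiple_in_cone:
  assumes "cone P" "x \<in> P"
  shows "multiple n x \<in> P"
  using assms by (induction n) (auto simp: cone_def multiple_Suc)

text \<open>If mx and ny lie in \<open>P\<close>, then so do mnx and mny, so one common multiple
  handles both elements. Torsion-freeness enters in the second clause, where mnx = 0 has to give x =
  0.\<close>

lemma cone_root_closure:
  assumes tf: "torsion_free TYPE('a::ab_group_add)" and P: "cone (P::'a set)"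
  shows "cone {x. \<exists>n>0. multiple n x \<in> P}" (is "cone ?Q")
proof -
  have "x + y \<in> ?Q" if "x \<in> ?Q" "y \<in> ?Q" for x y
  proof -
    from that obtain m n where mn: "m > 0" "multiple m x \<in> P" "n > 0" "multiple n y \<in> P"
      by auto
    have "multiple (m * n) x \<in> P" "multiple (m * n) y \<in> P"
      using multiple_in_cone[OF P] mn by (metis multiple_mult mult.commute)+
    then have "multiple (m * n) (x + y) \<in> P"
      using P by (simp add: cone_def multiple_add_right)
    then show ?thesis
      using mn by (intro CollectI exI[of _ "m * n"]) simp
  qed
  moreover have "x = 0" if "x \<in> ?Q" "- x \<in> ?Q" for x
  proof -
    from that obtain m n where mn: "m > 0" "multiple m x \<in> P" "n > 0" "- multiple n x \<in> P"
      by (auto simp: multiple_minus)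
    have "multiple (m * n) x \<in> P" "- multiple (m * n) x \<in> P"
      using multiple_in_cone[OF P] mn by (metis multiple_mult multiple_minus mult.commute)+
    then have "multiple (m * n) x = 0"
      using P by (auto simp: cone_def)
    then show ?thesis
      using torsion_free_multiple[OF tf] mn by simp
  qed
  moreover have "0 \<in> ?Q"
    using P by (auto simp: cone_def)
  ultimately show ?thesis
    unfolding cone_def by blast
qed

text \<open>The only threat to the last clause of \<open>cone\<close> is a relation that puts -(m +
  n)x in \<open>P\<close>. The hypothesis excludes it unless m = n = 0, and then both elements
  already lie in \<open>P\<close>.\<close>

lemma cone_adjoin:
  assumes P: "cone P" and x: "\<And>n. n > 0 \<Longrightarrow> - multiple n x \<notin> P"
  shows "cone {p + multiple n x | p n. p \<in> P}" (is "cone ?Q")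
proof -
  have "u + v \<in> ?Q" if "u \<in> ?Q" "v \<in> ?Q" for u v
  proof -
    from that obtain p m q n where
      *: "u = p + multiple m x" "v = q + multiple n x" "p \<in> P" "q \<in> P"
      by auto
    then have "u + v = (p + q) + multiple (m + n) x" "p + q \<in> P"
      using P by (auto simp: cone_def multiple_add_left algebra_simps)
    then show ?thesis by blast
  qed
  moreover have "u = 0" if "u \<in> ?Q" "- u \<in> ?Q" for u
  proof -
    from that obtain p m q n where
      *: "u = p + multiple m x" "- u = q + multiple n x" "p \<in> P" "q \<in> P"
      by auto
    have "(p + q) + multiple (m + n) x = (p + multiple m x) + (q + multiple n x)"
      by (simp add: multiple_add_left algebra_simps)
    also have "\<dots> = 0"
      using *(1,2) by (metis add.right_inverse)
    finally have "(p + q) + multiple (m + n) x = 0" .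
    then have sum: "- multiple (m + n) x = p + q"
      by (simp add: eq_neg_iff_add_eq_0 neg_eq_iff_add_eq_0 add.commute)
    have "p + q \<in> P"
      using * P by (auto simp: cone_def)
    then have mn: "m = 0" "n = 0"
      using x[of "m + n"] sum by (metis add_gr_0 not_gr_zero)+
    with * show ?thesis
      using P by (auto simp: cone_def)
  qed
  moreover have "0 \<in> ?Q"
    using P by (auto simp: cone_def intro!: exI[of _ 0] exI[of _ "0::nat"])
  ultimately show ?thesis
    unfolding cone_def by blast
qed

lemma total_cone_exists:
  assumes tf: "torsion_free TYPE('a::ab_group_add)"
  obtains P :: "'a::ab_group_add set" where "cone P" "\<And>x. x \<in> P \<or> - x \<in> P"
proof -
  have "\<exists>P\<in>Collect cone. \<forall>X\<in>Collect cone. P \<subseteq> X \<longrightarrow> X = (P :: 'a set)"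
  proof (rule subset_Zorn_nonempty)
    have "cone {0::'a}"
      by (simp add: cone_def)
    then show "Collect cone \<noteq> ({} :: 'a set set)"
      by blast
  next
    fix C :: "'a set set"
    assume ne: "C \<noteq> {}" and ch: "subset.chain (Collect cone) C"
    \<comment> \<open>Each clause of \<open>cone\<close> involves at most two elements, and any two
      elements of the union lie in one member of the chain.\<close>
    have two: "\<exists>R\<in>C. x \<in> R \<and> y \<in> R" if "x \<in> \<Union>C" "y \<in> \<Union>C" for x y
      using that ch unfolding subset.chain_def by blast
    have co: "cone R" if "R \<in> C" for R
      using that ch unfolding subset.chain_def by blast
    have "x + y \<in> \<Union>C" if "x \<in> \<Union>C" "y \<in> \<Union>C" for x y
      using two[OF that] co unfolding cone_def by blast
    moreover have "x = 0" if "x \<in> \<Union>C" "- x \<in> \<Union>C" for x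
      using two[OF that] co unfolding cone_def by blast
    moreover have "0 \<in> \<Union>C"
      using ne co unfolding cone_def by blast
    ultimately show "\<Union>C \<in> Collect cone"
      unfolding cone_def by blast
  qed
  then obtain P :: "'a set" where P: "cone P"
    and max: "\<And>X. cone X \<Longrightarrow> P \<subseteq> X \<Longrightarrow> X = P"
    by blast
  \<comment> \<open>The root closure is a cone containing \<open>P\<close>, so by maximality it is
    \<open>P\<close> itself.\<close>
  have root: "x \<in> P" if "multiple n x \<in> P" "n > 0" for n x
  proof -
    have "P \<subseteq> {x. \<exists>n>0. multiple n x \<in> P}"
      by (auto simp: multiple_Suc intro!: exI[of _ "1::nat"])
    then have "{x. \<exists>n>0. multiple n x \<in> P} = P"
      using max cone_root_closure[OF tf P] by blast
    then show ?thesis using that by blast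
  qed
  have "x \<in> P \<or> - x \<in> P" for x
  proof (rule disjCI)
    \<comment> \<open>By \<open>root\<close>, no positive multiple of -x lies in \<open>P\<close>,
      so x can be adjoined; maximality then forces x into \<open>P\<close>.\<close>
    assume "- x \<notin> P"
    then have "- multiple n x \<notin> P" if "n > 0" for n
      using root[of n "- x"] that by (auto simp: multiple_minus)
    then have "cone {p + multiple n x | p n. p \<in> P}"
      by (rule cone_adjoin[OF P])
    moreover have "P \<subseteq> {p + multiple n x | p n. p \<in> P}"
      by (auto intro!: exI[of _ "0::nat"])
    ultimately have "{p + multiple n x | p n. p \<in> P} = P"
      by (rule max)
    moreover have "0 + multiple (Suc 0) x \<in> {p + multiple n x | p n. p \<in> P}"
      using P unfolding cone_def by blast
    ultimately show "x \<in> P"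
      by (simp add: multiple_Suc)
  qed
  with P show ?thesis by (rule that)
qed

text \<open>The order is delivered as relations satisfying the class predicate, because it exists
  only under a hypothesis on the type. In this form it can be interpreted locally inside a
  proof.\<close>

lemma torsion_free_orderable:
  assumes "torsion_free TYPE('a::ab_group_add)"
  obtains le lt :: "'a::ab_group_add \<Rightarrow> 'a \<Rightarrow> bool"
    where "class.linordered_ab_group_add (+) 0 (-) uminus le lt"
proof -
  obtain P :: "'a set" where P: "cone P" and total: "\<And>x. x \<in> P \<or> - x \<in> P"
    using total_cone_exists[OF assms] by blast
  define le where "le x y \<longleftrightarrow> y - x \<in> P" for x y
  have add: "x + y \<in> P" if "x \<in> P" "y \<in> P" for x y
    using P that by (simp add: cone_def)
  have anti: "x = y" if "le x y" "le y x" for x y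
    using P that unfolding cone_def le_def by (metis minus_diff_eq right_minus_eq)
  \<comment> \<open>Translation invariance is immediate because the difference y - x does not change
    when both elements are shifted.\<close>
  have "class.linordered_ab_group_add (+) 0 (-) uminus le (\<lambda>x y. le x y \<and> \<not> le y x)"
  proof unfold_locales
    show "le x x" for x
      using P by (simp add: le_def cone_def)
    show "le x z" if "le x y" "le y z" for x y z
      using add[of "y - x" "z - y"] that by (simp add: le_def)
    show "le x y \<or> le y x" for x y
      using total[of "y - x"] by (simp add: le_def)
  qed (use anti in \<open>auto simp: le_def\<close>)
  then show ?thesis by (rule that)
qed

section \<open>Sums of two sets in an ordered group\<close>

context linordered_ab_group_add
begin

text \<open>A monotone path through the table of sums meets |A| + |B| - 1 distinct values. In the
  cell with columns x, x' and rows b0, b1 it can turn through x + b1 or x' + b0; if these differ,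
  both count and the sumset has at least |A| + |B| elements.\<close>

lemma small_sumset_consecutive_difference:
  assumes fin: "finite A" "finite B"
    and x: "x \<in> A" "x' \<in> A" "x < x'" "\<And>a. a \<in> A \<Longrightarrow> a \<le> x \<or> x' \<le> a"
    and b: "b0 \<in> B" "b1 \<in> B" "b0 < b1" "\<And>b. b \<in> B \<Longrightarrow> b = b0 \<or> b1 \<le> b"
    and small: "card {a + b | a b. a \<in> A \<and> b \<in> B} < card A + card B"
  shows "x' = x + (b1 - b0)"
proof (rule ccontr)
  assume "x' \<noteq> x + (b1 - b0)"
  then have corner: "x + b1 \<noteq> x' + b0"
    by (metis add_diff_eq add_diff_cancel)
  let ?S = "{a + b | a b. a \<in> A \<and> b \<in> B}"
  define M where "M = Max A"
  have M: "M \<in> A" "\<And>a. a \<in> A \<Longrightarrow> a \<le> M"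
    using Max_in[OF fin(1)] Max_ge[OF fin(1)] x(1) unfolding M_def by blast+
  \<comment> \<open>The pieces of the path: row b0 up to x, both intermediate corners of the cell,
    row b1 from x' to M, and finally column M above b1.\<close>
  define X1 where "X1 = (\<lambda>a. a + b0) ` {a \<in> A. a \<le> x}"
  define X2 where "X2 = {x + b1, x' + b0}"
  define X3 where "X3 = (\<lambda>a. a + b1) ` {a \<in> A. x' \<le> a}"
  define X4 where "X4 = (\<lambda>b. M + b) ` {b \<in> B. b1 < b}"
  note X = X1_def X2_def X3_def X4_def
  have finX: "finite X1" "finite X2" "finite X3" "finite X4"
    using fin by (auto simp: X)
  have split_A: "A = {a \<in> A. a \<le> x} \<union> {a \<in> A. x' \<le> a}"
    using x(4) by blast
  have "card X1 + card X3 = card {a \<in> A. a \<le> x} + card {a \<in> A. x' \<le> a}"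
    unfolding X by (simp add: card_image inj_on_def)
  also have "\<dots> = card ({a \<in> A. a \<le> x} \<union> {a \<in> A. x' \<le> a})"
    using fin x(3) by (intro card_Un_disjoint [symmetric]) auto
  finally have c13: "card X1 + card X3 = card A"
    using split_A by simp
  have "B = {b0, b1} \<union> {b \<in> B. b1 < b}"
    using b by (auto simp: le_less)
  then have "card B = card ({b0, b1} \<union> {b \<in> B. b1 < b})"
    by simp
  also have "\<dots> = card {b0, b1} + card {b \<in> B. b1 < b}"
    using fin b(3) by (intro card_Un_disjoint) auto
  finally have c4: "card B = 2 + card X4"
    using b(3) unfolding X by (simp add: card_image inj_on_def)
  have c2: "card X2 = 2"
    using corner by (simp add: X)
  \<comment> \<open>The values x + b0, x' + b1 and M + b1 separate the pieces: X1 <= x + b0 < X2 <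
    x' + b1 <= X3 <= M + b1 < X4.\<close>
  have order: "x + b0 < x' + b1" "x' + b1 \<le> M + b1"
    using x b M by (auto simp: add_strict_mono)
  have X1_le: "u \<le> x + b0" if "u \<in> X1" for u
    using that by (auto simp: X)
  have X2_gt: "x + b0 < u" and X2_lt: "u < x' + b1" if "u \<in> X2" for u
    using that x(3) b(3) by (auto simp: X add_strict_mono)
  have X3_ge: "x' + b1 \<le> u" and X3_le: "u \<le> M + b1" if "u \<in> X3" for u
    using that M by (auto simp: X)
  have X4_gt: "M + b1 < u" if "u \<in> X4" for u
    using that by (auto simp: X)
  have X12_lt: "u < x' + b1" if "u \<in> X1 \<union> X2" for u
    using that X2_lt le_less_trans[OF X1_le order(1)] by blast
  have X123_le: "u \<le> M + b1" if "u \<in> X1 \<union> X2 \<union> X3" for u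
    using that X3_le less_imp_le[OF less_le_trans[OF X12_lt order(2)]] by blast
  have "X1 \<inter> X2 = {}"
    using leD[OF X1_le] X2_gt by blast
  moreover have "(X1 \<union> X2) \<inter> X3 = {}"
    using leD[OF X3_ge] X12_lt by blast
  moreover have "(X1 \<union> X2 \<union> X3) \<inter> X4 = {}"
    using leD[OF X123_le] X4_gt by blast
  ultimately have "card (X1 \<union> X2 \<union> X3 \<union> X4) = card X1 + card X2 + card X3 + card X4"
    using finX by (simp add: card_Un_disjoint)
  moreover have "card (X1 \<union> X2 \<union> X3 \<union> X4) \<le> card ?S"
  proof (rule card_mono)
    show "finite ?S"
      using fin by (simp add: finite_image_set2)
    show "X1 \<union> X2 \<union> X3 \<union> X4 \<subseteq> ?S"
      using x b M unfolding X by blast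
  qed
  ultimately show False
    using small c13 c2 c4 by linarith
qed

text \<open>The two smallest elements b0, b1 of B stay fixed while the consecutive pair in A varies,
  so every gap of A equals b1 - b0.\<close>

lemma small_sumset_imp_progression:
  assumes fin: "finite A" "finite B" and "card B \<ge> 2"
    and small: "card {a + b | a b. a \<in> A \<and> b \<in> B} < card A + card B"
  shows "\<exists>f d. A = f ` {..<card A} \<and> (\<forall>i. f (Suc i) = f i + d)"
proof -
  define b0 where "b0 = Min B"
  define b1 where "b1 = Min (B - {b0})"
  have "B \<noteq> {}" "B - {b0} \<noteq> {}"
    using assms by (auto dest: subset_singletonD)
  then have b: "b0 \<in> B" "b1 \<in> B - {b0}" "\<And>b. b \<in> B \<Longrightarrow> b0 \<le> b"
      "\<And>b. b \<in> B - {b0} \<Longrightarrow> b1 \<le> b"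
    using fin Min_in[of B] Min_in[of "B - {b0}"] unfolding b0_def b1_def by auto
  have b01: "b0 < b1"
    using b(2) b(3)[of b1] by (auto simp: less_le)
  define xs where "xs = sorted_list_of_set A"
  have xs: "set xs = A" "length xs = card A" "sorted_wrt (<) xs"
    using fin by (auto simp: xs_def)
  \<comment> \<open>Recursion extends the progression to all indices, so its step relation needs no
    bound. For empty A the value \<open>xs ! 0\<close> is unspecified, but the index set is then
    empty as well.\<close>
  define f where "f = rec_nat (xs ! 0) (\<lambda>_ y. y + (b1 - b0))"
  have f: "f 0 = xs ! 0" "\<And>i. f (Suc i) = f i + (b1 - b0)"
    by (simp_all add: f_def)
  have "xs ! Suc i = xs ! i + (b1 - b0)" if "Suc i < card A" for i
  proof (rule small_sumset_consecutive_difference[OF fin])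
    show "xs ! i < xs ! Suc i"
      using xs that by (auto intro: sorted_wrt_nth_less)
    show "a \<le> xs ! i \<or> xs ! Suc i \<le> a" if "a \<in> A" for a
    proof -
      obtain j where j: "j < card A" "a = xs ! j"
        using \<open>a \<in> A\<close> xs by (metis in_set_conv_nth)
      consider "j < i" | "j = i" | "j = Suc i" | "Suc i < j"
        by linarith
      then show ?thesis
        using sorted_wrt_nth_less[OF xs(3), of j i] sorted_wrt_nth_less[OF xs(3), of "Suc i" j]
          j xs(2) \<open>Suc i < card A\<close>
        by cases auto
    qed
    show "b = b0 \<or> b1 \<le> b" if "b \<in> B" for b
      using b that by blast
  qed (use xs that b b01 small in \<open>auto simp flip: xs(1)\<close>)
  then have "f i = xs ! i" if "i < card A" for i
    using that by (induction i) (simp_all add: f)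
  then have "A = f ` {..<card A}"
    using xs by (auto simp: set_conv_nth image_iff)
  then show ?thesis
    using f by blast
qed

end

section \<open>Iterated sumsets and the dichotomy\<close>

lemma hfold_sumset_Suc:
  "hfold_sumset (Suc h) A = {a + b | a b. a \<in> A \<and> b \<in> hfold_sumset h A}"
proof (intro equalityI subsetI)
  fix s assume "s \<in> hfold_sumset (Suc h) A"
  then obtain a where a: "s = (\<Sum>i=1..Suc h. a i)" "\<forall>i\<in>{1..Suc h}. a i \<in> A"
    unfolding hfold_sumset_def by blast
  then have "s = a (Suc h) + (\<Sum>i=1..h. a i)" "a (Suc h) \<in> A" "\<forall>i\<in>{1..h}. a i \<in> A"
    by (auto simp: add.commute)
  then show "s \<in> {a + b | a b. a \<in> A \<and> b \<in> hfold_sumset h A}"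
    unfolding hfold_sumset_def by blast
next
  fix s assume "s \<in> {a + b | a b. a \<in> A \<and> b \<in> hfold_sumset h A}"
  then obtain x a where a: "s = x + (\<Sum>i=1..h. a i)" "x \<in> A" "\<forall>i\<in>{1..h}. a i \<in> A"
    unfolding hfold_sumset_def by blast
  have "(\<Sum>i=1..h. (a(Suc h := x)) i) = (\<Sum>i=1..h. a i)"
    by (intro sum.cong) auto
  then have "s = (\<Sum>i=1..Suc h. (a(Suc h := x)) i)" "\<forall>i\<in>{1..Suc h}. (a(Suc h := x)) i \<in> A"
    using a by (auto simp: add.commute)
  then show "s \<in> hfold_sumset (Suc h) A"
    unfolding hfold_sumset_def by blast
qed

lemma hfold_sumset_0: "hfold_sumset 0 A = {0}"
  by (auto simp: hfold_sumset_def)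

lemma finite_hfold_sumset:
  assumes "finite A"
  shows "finite (hfold_sumset h A)"
  by (induction h) (simp_all add: hfold_sumset_0 hfold_sumset_Suc assms finite_image_set2)

text \<open>Indices add along with the terms: every h-fold sum is h f(0) + i d with i between 0 and
  h(k - 1).\<close>

lemma card_hfold_sumset_progression:
  fixes A :: "'a::ab_group_add set"
  assumes A: "A = f ` {..<k}" and f: "\<And>i. f (Suc i) = f i + d"
  shows "card (hfold_sumset h A) \<le> h * (k - 1) + 1"
proof -
  have f_multiple: "f i = f 0 + multiple i d" for i
    by (induction i) (simp_all add: f multiple_Suc algebra_simps)
  have "hfold_sumset h A \<subseteq> (\<lambda>i. multiple h (f 0) + multiple i d) ` {..h * (k - 1)}"
  proof (induction h)
    case 0
    show ?case by (simp add: hfold_sumset_0)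
  next
    case (Suc h)
    show ?case
    proof
      fix s assume "s \<in> hfold_sumset (Suc h) A"
      then obtain i j where *: "i < k" "j \<le> h * (k - 1)"
          "s = f i + (multiple h (f 0) + multiple j d)"
        using Suc.IH A by (fastforce simp: hfold_sumset_Suc)
      then have "s = multiple (Suc h) (f 0) + multiple (i + j) d"
        using f_multiple[of i] by (simp add: multiple_Suc multiple_add_left algebra_simps)
      moreover have "i + j \<le> Suc h * (k - 1)"
        using * by simp
      ultimately show "s \<in> (\<lambda>i. multiple (Suc h) (f 0) + multiple i d) ` {..Suc h * (k - 1)}"
        by blast
    qed
  qed
  from card_mono[OF _ this] card_image_le[of "{..h * (k - 1)}"] show ?thesis
    by (fastforce intro: order_trans)
qed

text \<open>The contrapositive of \<open>small_sumset_imp_progression\<close>, applied to A and hA,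
  makes each further summand add at least |A| elements. The induction starts at 1 because 0A has a
  single element, too few for that criterion.\<close>

lemma card_hfold_sumset_not_progression:
  fixes A :: "'a::ab_group_add set"
  assumes tf: "torsion_free TYPE('a)" and fin: "finite A" and "card A \<ge> 2" and "h \<ge> 1"
    and not_ap: "\<nexists>f d. A = f ` {..<card A} \<and> (\<forall>i. f (Suc i) = f i + d)"
  shows "card (hfold_sumset h A) \<ge> h * card A"
  using \<open>h \<ge> 1\<close>
proof (induction h rule: dec_induct)
  case base
  have "hfold_sumset 1 A = A"
    by (simp add: hfold_sumset_Suc hfold_sumset_0)
  then show ?case by simp
next
  case (step h)
  obtain le lt :: "'a \<Rightarrow> 'a \<Rightarrow> bool"
    where "class.linordered_ab_group_add (+) 0 (-) uminus le lt"
    using torsion_free_orderable[OF tf] .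
  then interpret ord: linordered_ab_group_add "(+)" 0 "(-)" uminus le lt .
  \<comment> \<open>This secures the two distinct elements of hA that play the roles of b0 and
    b1.\<close>
  have "1 * 2 \<le> h * card A"
    using step.hyps \<open>card A \<ge> 2\<close> by (intro mult_le_mono)
  then have "card (hfold_sumset h A) \<ge> 2"
    using step.IH by simp
  then have "card A + card (hfold_sumset h A) \<le> card (hfold_sumset (Suc h) A)"
    using ord.small_sumset_imp_progression[OF fin finite_hfold_sumset[OF fin]] not_ap
    by (simp add: hfold_sumset_Suc) (meson not_le)
  then show ?case
    using step.IH by simp
qed

theorem theorem3p6:
  fixes h k :: nat
  assumes "torsion_free TYPE('a::ab_group_add)"
    and "h \<ge> 2" and "k \<ge> 4"
  shows "sumset_sizes TYPE('a) h k \<inter> {h * k - h + 2 .. h * k - 1} = {}"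
proof -
  \<comment> \<open>The forbidden interval consists of the integers strictly between these two
    bounds.\<close>
  have "card (hfold_sumset h A) \<le> h * k - h + 1 \<or> h * k \<le> card (hfold_sumset h A)"
    if A: "finite A" "card A = k" for A :: "'a set"
  proof (cases "\<exists>f d. A = f ` {..<k} \<and> (\<forall>i. f (Suc i) = f i + d)")
    case True
    then obtain f d where "A = f ` {..<k}" "\<And>i. f (Suc i) = f i + d"
      by blast
    then have "card (hfold_sumset h A) \<le> h * (k - 1) + 1"
      by (rule card_hfold_sumset_progression)
    then show ?thesis
      by (simp add: diff_mult_distrib2)
  next
    case False
    then have "card (hfold_sumset h A) \<ge> h * k"
      using card_hfold_sumset_not_progression[OF assms(1) A(1), of h] A assms by simp
    then show ?thesis ..
  qed
  \<comment> \<open>With truncated subtraction, positivity is what turns c <= hk - 1 into c <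
    hk.\<close>
  moreover have "h * k > 0"
    using assms by simp
  ultimately show ?thesis
    unfolding sumset_sizes_def by fastforce
qed

end
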